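(* Let $n\ge 4$ and let $\mathbb{D}$ be a $\vec{\mathbb{P}}_3$-free digraph. Then $\mathbb{D}$ admits a homomorphism to $\mathbb{TC}_n$ if and only if $\mathbb{D}$ is a loopless oriented graph with no induced subgraph isomorphic to any of $\mathbb{T}_4^a$, $\mathbb{T}_4^b$, $\mathbb{RT}_5$, $\mathbb{T}_5^c$, $\mathbb{TT}_n$, $\mathbb{TC}_{n+1}$.
   Context: $\vec{\mathbb{P}}_3$ is the directed path $1\to2\to3$; $\vec{\mathbb{P}}_3$-free means no induced subgraph isomorphic to it. An oriented graph has no pair of symmetric edges $(u,v),(v,u)$. $\mathbb{TT}_m$ is the transitive tournament on $\{1,\dots,m\}$ with edges $(i,j)$ for $i<j$, and $\mathbb{TC}_m$ is obtained from $\mathbb{TT}_m$ by reversing the edge $(1,m)$ to $(m,1)$. $\mathbb{T}_4^a$: vertices $1,2,3,4$, edges $(1,2),(1,3),(1,4),(2,3),(3,4),(4,2)$ (a source dominating a directed triangle). $\mathbb{T}_4^b$: edges $(2,1),(3,1),(4,1),(2,3),(3,4),(4,2)$ (a directed triangle dominating a sink). $\mathbb{RT}_5$: vertices $\mathbb{Z}_5$, edge $(i,j)$ iff $j-i\in\{1,3\}\pmod 5$. $\mathbb{T}_5^c$: vertices $1,\dots,5$, edges $(1,2),(2,3),(3,4),(1,3),(1,4),(2,4),(5,1),(5,2),(3,5),(4,5)$. *)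

theory Defs
  imports "Graph_Theory.Graph_Theory"
begin

text \<open>
  Digraphs are \<^typ>\<open>'a pair_pre_digraph\<close> records satisfying \<^locale>\<open>pair_wf_digraph\<close>: a vertex set
  together with a binary edge relation on it. Loops, symmetric pairs of edges, infinite vertex sets
  and the empty digraph are all permitted.
\<close>

definition digraph_hom :: "('a \<Rightarrow> 'b) \<Rightarrow> 'a pair_pre_digraph \<Rightarrow> 'b pair_pre_digraph \<Rightarrow> bool" where
  "digraph_hom f G H \<longleftrightarrow>
     (\<forall>v \<in> pverts G. f v \<in> pverts H) \<and> (\<forall>(u, v) \<in> parcs G. (f u, f v) \<in> parcs H)"

definition admits_hom :: "'a pair_pre_digraph \<Rightarrow> 'b pair_pre_digraph \<Rightarrow> bool" where
  "admits_hom G H \<longleftrightarrow> (\<exists>f. digraph_hom f G H)"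

definition has_induced :: "'a pair_pre_digraph \<Rightarrow> 'b pair_pre_digraph \<Rightarrow> bool" where
  "has_induced G F \<longleftrightarrow>
     (\<exists>H. induced_subgraph H (with_proj G) \<and> digraph_iso H (with_proj F))"

text \<open>
  The condition \<open>u \<noteq> v\<close> keeps this independent of looplessness, which is
  \<^locale>\<open>pair_loopfree_digraph\<close>.
\<close>

definition oriented_graph :: "'a pair_pre_digraph \<Rightarrow> bool" where
  "oriented_graph G \<longleftrightarrow>
     pair_wf_digraph G \<and> (\<forall>u v. u \<noteq> v \<longrightarrow> \<not> ((u, v) \<in> parcs G \<and> (v, u) \<in> parcs G))"

definition dipath3 :: "nat pair_pre_digraph" where
  "dipath3 = \<lparr> pverts = {1, 2, 3}, parcs = {(1, 2), (2, 3)} \<rparr>"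

definition TT :: "nat \<Rightarrow> nat pair_pre_digraph" where
  "TT m = \<lparr> pverts = {1..m}, parcs = {(i, j). i \<in> {1..m} \<and> j \<in> {1..m} \<and> i < j} \<rparr>"

text \<open>Only meaningful for \<open>m \<ge> 2\<close>: the edge \<open>(1, m)\<close> must exist in order to be reversed.\<close>

definition TC :: "nat \<Rightarrow> nat pair_pre_digraph" where
  "TC m = \<lparr> pverts = pverts (TT m), parcs = insert (m, 1) (parcs (TT m) - {(1, m)}) \<rparr>"

definition T4a :: "nat pair_pre_digraph" where
  "T4a = \<lparr> pverts = {1, 2, 3, 4}, parcs = {(1, 2), (1, 3), (1, 4), (2, 3), (3, 4), (4, 2)} \<rparr>"

definition T4b :: "nat pair_pre_digraph" where
  "T4b = \<lparr> pverts = {1, 2, 3, 4}, parcs = {(2, 1), (3, 1), (4, 1), (2, 3), (3, 4), (4, 2)} \<rparr>"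

text \<open>The vertex set \<open>\<int>/5\<int>\<close> is represented by the residues \<open>0, \<dots>, 4\<close>.\<close>

definition RT5 :: "int pair_pre_digraph" where
  "RT5 = \<lparr> pverts = {0..<5},
           parcs = {(i, j). i \<in> {0..<5} \<and> j \<in> {0..<5} \<and> (j - i) mod 5 \<in> {1, 3}} \<rparr>"

definition T5c :: "nat pair_pre_digraph" where
  "T5c = \<lparr> pverts = {1, 2, 3, 4, 5},
           parcs = {(1, 2), (2, 3), (3, 4), (1, 3), (1, 4), (2, 4),
                    (5, 1), (5, 2), (3, 5), (4, 5)} \<rparr>"

end

theory Submission
  imports Defs
begin

text \<open>
  A weakly connected component of \<open>D\<close> without directed triangles is a strict partial order, and
  forbidding \<open>TT\<^sub>n\<close> bounds its height, so it maps to \<open>{1..n-1}\<close>. In a component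
  with a triangle \<open>a, b, c\<close>, excluding \<open>T4a\<close> and \<open>T4b\<close> places every vertex in one of
  the three classes of vertices that can replace \<open>a\<close>, \<open>b\<close> or \<open>c\<close> in that triangle. Excluding
  \<open>RT5\<close> makes the edges between consecutive classes complete, and excluding \<open>T5c\<close> leaves at most one
  class with edges inside. That class is a strict partial order, and
  excluding \<open>TC\<^sub>n\<^sub>+\<^sub>1\<close> bounds its chains by \<open>n - 2\<close>; it maps to \<open>{2..n-1}\<close> and the other two classes map to
  \<open>n\<close> and \<open>1\<close>.
\<close>

subsection \<open>Tournaments and induced subgraphs\<close>

text \<open>The image of \<open>F\<close> under the isomorphism built from \<open>g\<close> is the
  required subgraph. The direction from arcs of \<open>D\<close> back to arcs of \<open>F\<close>
  makes it induced.\<close>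

lemma has_inducedI:
  fixes D :: "'a pair_pre_digraph" and F :: "'b pair_pre_digraph"
  assumes D: "pair_wf_digraph D" and F: "pair_wf_digraph F"
    and inj: "inj_on g (pverts F)" and ran: "g ` pverts F \<subseteq> pverts D"
    and arc: "\<And>u v. u \<in> pverts F \<Longrightarrow> v \<in> pverts F \<Longrightarrow> (g u, g v) \<in> parcs D \<longleftrightarrow> (u, v) \<in> parcs F"
  shows "has_induced D F"
proof -
  interpret D: pair_wf_digraph D by fact
  interpret F: pair_wf_digraph F by fact
  define iso where "iso = \<lparr>iso_verts = g, iso_arcs = map_prod g g, iso_head = snd, iso_tail = fst\<rparr>"
  let ?H = "app_iso iso (with_proj F)"
  have "inj_on (map_prod g g) (parcs F)"
    by (intro inj_on_subset[OF map_prod_inj_on[OF inj inj]]) (auto dest: F.in_arcsD1 F.in_arcsD2)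
  then have iso: "pre_digraph.digraph_isomorphism (with_proj F) iso"
    using F.wf_digraph inj by (auto simp: pre_digraph.digraph_isomorphism_def iso_def)
  have arcs: "map_prod g g ` parcs F = {e \<in> parcs D. fst e \<in> g ` pverts F \<and> snd e \<in> g ` pverts F}"
    (is "?L = ?R")
  proof (intro equalityI subsetI)
    show "e \<in> ?R" if "e \<in> ?L" for e
      using that arc by (auto dest: F.in_arcsD1 F.in_arcsD2)
    show "e \<in> ?L" if "e \<in> ?R" for e
    proof -
      have "e \<in> parcs D" "fst e \<in> g ` pverts F" "snd e \<in> g ` pverts F" using that by auto
      moreover from this obtain u v where "fst e = g u" "snd e = g v" "u \<in> pverts F" "v \<in> pverts F"
        by blast
      ultimately have "e = map_prod g g (u, v)" "(u, v) \<in> parcs F"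
        using arc by (auto simp: prod_eq_iff) (metis prod.collapse)
      then show ?thesis by (rule image_eqI)
    qed
  qed
  have wf: "wf_digraph ?H"
    using F.wf_digraphI_app_iso[OF iso] .
  have "induced_subgraph ?H (with_proj D)"
    using wf D.wf_digraph ran arcs
    by (auto simp: induced_subgraph_def subgraph_def compatible_def iso_def)
  \<comment> \<open>\<open>has_induced\<close> asks for an isomorphism onto \<open>F\<close>, while
    \<open>iso\<close> starts at \<open>F\<close>, hence the swap.\<close>
  moreover have "digraph_iso ?H (with_proj F)"
    using iso by (intro digraph_iso_swap[OF F.wf_digraph]) (auto simp: digraph_iso_def)
  ultimately show ?thesis
    by (auto simp: has_induced_def)
qed

lemma has_induced_admits_hom:
  fixes D :: "'a pair_pre_digraph" and F :: "'b pair_pre_digraph"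
  assumes "has_induced D F"
  shows "admits_hom F D"
proof -
  obtain H where H: "induced_subgraph H (with_proj D)" and iso: "digraph_iso H (with_proj F)"
    using assms by (auto simp: has_induced_def)
  have "wf_digraph H" using H by (auto simp: induced_subgraph_def subgraph_def)
  then have "digraph_iso (with_proj F) H" using iso by (rule digraph_iso_swap)
  then obtain f where f: "pre_digraph.digraph_isomorphism (with_proj F) f" "H = app_iso f (with_proj F)"
    by (auto simp: digraph_iso_def)
  have "(iso_verts f u, iso_verts f v) \<in> parcs D" if "(u, v) \<in> parcs F" for u v
  proof -
    have "iso_arcs f (u, v) = (iso_verts f u, iso_verts f v)" "iso_arcs f (u, v) \<in> parcs D"
      using that f H
      by (auto simp: pre_digraph.digraph_isomorphism_def induced_subgraph_def subgraph_def
          compatible_def prod_eq_iff image_subset_iff)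
    then show ?thesis by simp
  qed
  moreover have "iso_verts f u \<in> pverts D" if "u \<in> pverts F" for u
    using that f H by (auto simp: induced_subgraph_def subgraph_def)
  ultimately show ?thesis
    by (auto simp: admits_hom_def digraph_hom_def intro!: exI[of _ "iso_verts f"])
qed

lemma admits_hom_trans:
  assumes "admits_hom F G" "admits_hom G H"
  shows "admits_hom F H"
proof -
  obtain f g where "digraph_hom f F G" "digraph_hom g G H"
    using assms by (auto simp: admits_hom_def)
  then have "digraph_hom (g \<circ> f) F H" by (auto simp: digraph_hom_def)
  then show ?thesis by (auto simp: admits_hom_def)
qed

text \<open>Reduces the forward direction to showing that no obstruction has a homomorphism to the
  target.\<close>

lemma not_has_inducedI:
  "admits_hom D T \<Longrightarrow> \<not> admits_hom F T \<Longrightarrow> \<not> has_induced D F"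
  using has_induced_admits_hom admits_hom_trans by blast

definition tournament :: "'a pair_pre_digraph \<Rightarrow> bool" where
  "tournament F \<longleftrightarrow> pair_wf_digraph F \<and>
     (\<forall>u \<in> pverts F. \<forall>v \<in> pverts F. u \<noteq> v \<longrightarrow> (u, v) \<in> parcs F \<or> (v, u) \<in> parcs F)"

text \<open>Two distinct vertices are joined by an arc, so a common image would carry a
  loop.\<close>

lemma tournament_hom_inj_on:
  assumes "tournament F" and "\<And>u v. (u, v) \<in> parcs F \<Longrightarrow> (g u, g v) \<in> parcs D"
    and "\<And>u. (u, u) \<notin> parcs D"
  shows "inj_on g (pverts F)"
  using assms by (metis inj_onI tournament_def)

text \<open>In a loopless oriented graph every homomorphic image of a tournament is an induced copy:
  a missing arc of \<open>F\<close> between distinct vertices has its reverse in \<open>F\<close>,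
  and asymmetry of \<open>D\<close> then excludes the arc between the images. Assumption
  \<open>card\<close> gives every vertex a neighbour, so that its image is an endpoint of an arc and
  hence a vertex of \<open>D\<close>.\<close>

lemma tournament_has_inducedI:
  assumes D: "pair_loopfree_digraph D" "oriented_graph D" and F: "tournament F"
    and card: "\<And>v. pverts F \<noteq> {v}"
    and hom: "\<And>u v. (u, v) \<in> parcs F \<Longrightarrow> (g u, g v) \<in> parcs D"
  shows "has_induced D F"
proof -
  interpret D: pair_loopfree_digraph D by fact
  have irr: "(u, u) \<notin> parcs D" for u using D.pair_no_loops by fastforce
  have asym: "(v, u) \<notin> parcs D" if "(u, v) \<in> parcs D" for u v
    using D that irr unfolding oriented_graph_def by metis
  have inj: "inj_on g (pverts F)" by (rule tournament_hom_inj_on[OF F hom irr])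
  have "g u \<in> pverts D" if u: "u \<in> pverts F" for u
  proof -
    obtain v where "v \<in> pverts F" "v \<noteq> u" using card[of u] u by blast
    then have "(u, v) \<in> parcs F \<or> (v, u) \<in> parcs F" using F u by (auto simp: tournament_def)
    then show ?thesis using hom D.in_arcsD1 D.in_arcsD2 by blast
  qed
  moreover have "(g u, g v) \<in> parcs D \<longleftrightarrow> (u, v) \<in> parcs F" if "u \<in> pverts F" "v \<in> pverts F" for u v
    using that F hom irr asym unfolding tournament_def by metis
  ultimately show ?thesis
    using F inj by (intro has_inducedI[of D F g] D.pair_wf_digraph_axioms) (auto simp: tournament_def)
qed

section \<open>Arcs of the concrete tournaments\<close>

lemma pair_wf_digraphI:
  assumes "\<And>u v. (u, v) \<in> parcs G \<Longrightarrow> u \<in> pverts G \<and> v \<in> pverts G"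
  shows "pair_wf_digraph G"
  using assms by unfold_locales auto

lemma pverts_TT [simp]: "pverts (TT m) = {1..m}"
  by (simp add: TT_def)

lemma in_parcs_TT: "(i, j) \<in> parcs (TT m) \<longleftrightarrow> 1 \<le> i \<and> i < j \<and> j \<le> m"
  by (auto simp: TT_def)

lemma pverts_TC [simp]: "pverts (TC m) = {1..m}"
  by (simp add: TC_def)

lemma in_parcs_TC:
  "(i, j) \<in> parcs (TC m) \<longleftrightarrow> i = m \<and> j = 1 \<or> 1 \<le> i \<and> i < j \<and> j \<le> m \<and> \<not> (i = 1 \<and> j = m)"
  by (auto simp: TC_def in_parcs_TT)

lemma parcs_RT5:
  "parcs RT5 = {(0, 1), (1, 2), (2, 3), (3, 4), (4, 0), (0, 3), (1, 4), (2, 0), (3, 1), (4, 2)}"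
proof -
  have residues: "i \<in> {0..<5} \<longleftrightarrow> i = 0 \<or> i = 1 \<or> i = 2 \<or> i = 3 \<or> i = 4" for i :: int
    by (simp only: atLeastLessThan_iff) arith
  have "e \<in> {(0, 1), (1, 2), (2, 3), (3, 4), (4, 0), (0, 3), (1, 4), (2, 0), (3, 1), (4, 2)}"
    if "e \<in> parcs RT5" for e
  proof -
    obtain i j where "e = (i, j)" by (cases e)
    then have "i \<in> {0..<5}" "j \<in> {0..<5}" "(j - i) mod 5 \<in> {1, 3}"
      using that by (auto simp: RT5_def)
    then show ?thesis unfolding residues \<open>e = (i, j)\<close> by (elim disjE) simp_all
  qed
  then show ?thesis by (intro equalityI subsetI) (assumption | force simp: RT5_def)+
qed

lemma pverts_RT5: "pverts RT5 = {0, 1, 2, 3, 4}"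
  by (auto simp: RT5_def)

lemma tournament_TT: "tournament (TT m)"
  by (auto simp: tournament_def in_parcs_TT intro!: pair_wf_digraphI)

lemma tournament_TC: "m \<ge> 2 \<Longrightarrow> tournament (TC m)"
  by (auto simp: tournament_def in_parcs_TC intro!: pair_wf_digraphI)

lemma tournament_T4a: "tournament T4a"
  by (auto simp: tournament_def T4a_def intro!: pair_wf_digraphI)

lemma tournament_T4b: "tournament T4b"
  by (auto simp: tournament_def T4b_def intro!: pair_wf_digraphI)

lemma tournament_RT5: "tournament RT5"
  by (auto simp: tournament_def parcs_RT5 pverts_RT5 intro!: pair_wf_digraphI)

lemma tournament_T5c: "tournament T5c"
  by (auto simp: tournament_def T5c_def intro!: pair_wf_digraphI)

subsection \<open>Obstructions do not map to the target\<close>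

text \<open>Every arc other than \<open>(n, 1)\<close> increases, and no closed walk increases
  throughout.\<close>

lemma TC_triangle:
  assumes "(a, b) \<in> parcs (TC n)" "(b, c) \<in> parcs (TC n)" "(c, a) \<in> parcs (TC n)"
  shows "a = n \<and> b = 1 \<or> b = n \<and> c = 1 \<or> c = n \<and> a = 1"
proof -
  have less: "i < j" if "(i, j) \<in> parcs (TC n)" "\<not> (i = n \<and> j = 1)" for i j
    using that by (auto simp: in_parcs_TC)
  show ?thesis
    using less[OF assms(1)] less[OF assms(2)] less[OF assms(3)] by linarith
qed

lemma TC_from_last: "n \<ge> 2 \<Longrightarrow> (n, j) \<in> parcs (TC n) \<Longrightarrow> j = 1"
  by (auto simp: in_parcs_TC)

lemma TC_into_first: "n \<ge> 2 \<Longrightarrow> (i, 1) \<in> parcs (TC n) \<Longrightarrow> i = n"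
  by (auto simp: in_parcs_TC)

lemma TC_irrefl: "n \<ge> 2 \<Longrightarrow> (i, i) \<notin> parcs (TC n)"
  by (auto simp: in_parcs_TC)

lemma TC_asym: "n \<ge> 3 \<Longrightarrow> (i, j) \<in> parcs (TC n) \<Longrightarrow> (j, i) \<notin> parcs (TC n)"
  by (auto simp: in_parcs_TC)

text \<open>By \<open>TC_triangle\<close> some triangle vertex maps to \<open>1\<close> and another
  to \<open>n\<close>. The source dominates both: the first arc forces \<open>f 1 = n\<close>, and
  the second is then a loop.\<close>

lemma T4a_not_hom_TC:
  assumes "n \<ge> 2"
  shows "\<not> admits_hom T4a (TC n)"
proof
  assume "admits_hom T4a (TC n)"
  then obtain f where f: "\<And>u v. (u, v) \<in> parcs T4a \<Longrightarrow> (f u, f v) \<in> parcs (TC n)"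
    unfolding admits_hom_def digraph_hom_def by blast
  have "(f 1, f 2) \<in> parcs (TC n)" "(f 1, f 3) \<in> parcs (TC n)" "(f 1, f 4) \<in> parcs (TC n)"
    "(f 2, f 3) \<in> parcs (TC n)" "(f 3, f 4) \<in> parcs (TC n)" "(f 4, f 2) \<in> parcs (TC n)"
    using f by (simp_all add: T4a_def)
  with TC_triangle[OF this(4-6)] TC_from_last TC_into_first TC_irrefl \<open>n \<ge> 2\<close> show False
    by metis
qed

text \<open>Dual argument: the arc from the triangle vertex over \<open>n\<close> forces
  \<open>f 1 = 1\<close>, and the arc from the one over \<open>1\<close> is then a loop.\<close>

lemma T4b_not_hom_TC:
  assumes "n \<ge> 2"
  shows "\<not> admits_hom T4b (TC n)"
proof
  assume "admits_hom T4b (TC n)"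
  then obtain f where f: "\<And>u v. (u, v) \<in> parcs T4b \<Longrightarrow> (f u, f v) \<in> parcs (TC n)"
    unfolding admits_hom_def digraph_hom_def by blast
  have "(f 2, f 1) \<in> parcs (TC n)" "(f 3, f 1) \<in> parcs (TC n)" "(f 4, f 1) \<in> parcs (TC n)"
    "(f 2, f 3) \<in> parcs (TC n)" "(f 3, f 4) \<in> parcs (TC n)" "(f 4, f 2) \<in> parcs (TC n)"
    using f by (simp_all add: T4b_def)
  with TC_triangle[OF this(4-6)] TC_from_last TC_into_first TC_irrefl \<open>n \<ge> 2\<close> show False
    by metis
qed

text \<open>The triangles \<open>0, 1, 2\<close> and \<open>2, 3, 4\<close> share only one vertex,
  but by injectivity both must contain the unique arc mapped to \<open>(n, 1)\<close>.\<close>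

lemma RT5_not_hom_TC:
  assumes "n \<ge> 2"
  shows "\<not> admits_hom RT5 (TC n)"
proof
  assume "admits_hom RT5 (TC n)"
  then obtain f where f: "\<And>u v. (u, v) \<in> parcs RT5 \<Longrightarrow> (f u, f v) \<in> parcs (TC n)"
    unfolding admits_hom_def digraph_hom_def by blast
  have inj: "inj_on f (pverts RT5)"
    using assms f TC_irrefl by (intro tournament_hom_inj_on[OF tournament_RT5, of f "TC n"]) auto
  have "(f 0, f 1) \<in> parcs (TC n)" "(f 1, f 2) \<in> parcs (TC n)" "(f 2, f 0) \<in> parcs (TC n)"
    "(f 2, f 3) \<in> parcs (TC n)" "(f 3, f 4) \<in> parcs (TC n)" "(f 4, f 2) \<in> parcs (TC n)"
    using f by (simp_all add: parcs_RT5)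
  from TC_triangle[OF this(1-3)] TC_triangle[OF this(4-6)] inj show False
    by (auto simp: inj_on_def pverts_RT5)
qed

text \<open>The triangles \<open>5, 1, 3\<close> and \<open>5, 2, 3\<close> and
  \<open>5, 1, 4\<close> have no arc common to all three, but by injectivity a single arc is mapped
  to \<open>(n, 1)\<close> in each of them.\<close>

lemma T5c_not_hom_TC:
  assumes "n \<ge> 2"
  shows "\<not> admits_hom T5c (TC n)"
proof
  assume "admits_hom T5c (TC n)"
  then obtain f where f: "\<And>u v. (u, v) \<in> parcs T5c \<Longrightarrow> (f u, f v) \<in> parcs (TC n)"
    unfolding admits_hom_def digraph_hom_def by blast
  have inj: "inj_on f (pverts T5c)"
    using assms f TC_irrefl by (intro tournament_hom_inj_on[OF tournament_T5c, of f "TC n"]) auto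
  have "(f 5, f 1) \<in> parcs (TC n)" "(f 1, f 3) \<in> parcs (TC n)" "(f 3, f 5) \<in> parcs (TC n)"
    "(f 5, f 2) \<in> parcs (TC n)" "(f 2, f 3) \<in> parcs (TC n)"
    "(f 1, f 4) \<in> parcs (TC n)" "(f 4, f 5) \<in> parcs (TC n)"
    using f by (simp_all add: T5c_def)
  from TC_triangle[OF this(1-3)] TC_triangle[OF this(4,5,3)] TC_triangle[OF this(1,6,7)] inj
  show False
    by (auto simp: inj_on_def T5c_def)
qed

text \<open>An injective map between sets of size \<open>n\<close> is onto, so the cycle
  \<open>1, 2, n\<close> of the target would pull back to a directed cycle in a transitive
  tournament.\<close>

lemma TT_not_hom_TC:
  assumes "n \<ge> 3"
  shows "\<not> admits_hom (TT n) (TC n)"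
proof
  assume "admits_hom (TT n) (TC n)"
  then obtain f where ran: "\<And>i. i \<in> pverts (TT n) \<Longrightarrow> f i \<in> pverts (TC n)"
    and f: "\<And>u v. (u, v) \<in> parcs (TT n) \<Longrightarrow> (f u, f v) \<in> parcs (TC n)"
    unfolding admits_hom_def digraph_hom_def by blast
  have inj: "inj_on f {1..n}"
    using assms f TC_irrefl tournament_hom_inj_on[OF tournament_TT, of n f "TC n"] by auto
  have "f ` {1..n} = {1..n}"
    using ran by (intro endo_inj_surj inj) auto
  moreover have "1 \<in> {1..n}" "2 \<in> {1..n}" "n \<in> {1..n}" using \<open>n \<ge> 3\<close> by auto
  ultimately have "1 \<in> f ` {1..n}" "2 \<in> f ` {1..n}" "n \<in> f ` {1..n}" by simp_all
  then obtain i j k where ijk: "i \<in> {1..n}" "f i = 1" "j \<in> {1..n}" "f j = 2" "k \<in> {1..n}" "f k = n"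
    by (elim imageE) (simp only: eq_commute)
  \<comment> \<open>Arcs are reflected: if \<open>u < v\<close> fails, equality would give a loop
    and \<open>v < u\<close> a symmetric pair in the target.\<close>
  have refl: "u < v" if "(f u, f v) \<in> parcs (TC n)" "u \<in> {1..n}" "v \<in> {1..n}" for u v
  proof (rule ccontr)
    assume "\<not> u < v"
    then have "u = v \<or> (v, u) \<in> parcs (TT n)" using that by (auto simp: in_parcs_TT)
    then show False using f TC_irrefl TC_asym \<open>n \<ge> 3\<close> that(1) by fastforce
  qed
  have "i < j" "j < k" "k < i"
    using \<open>n \<ge> 3\<close> ijk by (auto intro!: refl simp: in_parcs_TC)
  then show False by simp
qed

text \<open>Pigeonhole: a homomorphism from a tournament to a loopless digraph is injective.\<close>

lemma TC_Suc_not_hom_TC: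
  assumes "n \<ge> 2"
  shows "\<not> admits_hom (TC (n + 1)) (TC n)"
proof
  assume "admits_hom (TC (n + 1)) (TC n)"
  then obtain f where ran: "\<And>i. i \<in> pverts (TC (n + 1)) \<Longrightarrow> f i \<in> pverts (TC n)"
    and f: "\<And>u v. (u, v) \<in> parcs (TC (n + 1)) \<Longrightarrow> (f u, f v) \<in> parcs (TC n)"
    unfolding admits_hom_def digraph_hom_def by blast
  have inj: "inj_on f {1..n + 1}"
    using assms f TC_irrefl tournament_hom_inj_on[OF tournament_TC, of "n + 1" f "TC n"] by auto
  have "card {1..n + 1} \<le> card {1..n}"
    using ran by (intro card_inj_on_le[OF inj]) auto
  then show False by simp
qed

lemma admits_hom_TC_obstruction_free:
  fixes D :: "'a pair_pre_digraph"
  assumes n: "n \<ge> 3" and wf: "pair_wf_digraph D" and hom: "admits_hom D (TC n)"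
  shows "pair_loopfree_digraph D \<and> oriented_graph D \<and>
    \<not> has_induced D T4a \<and> \<not> has_induced D T4b \<and>
    \<not> has_induced D RT5 \<and> \<not> has_induced D T5c \<and>
    \<not> has_induced D (TT n) \<and> \<not> has_induced D (TC (n + 1))"
proof -
  interpret pair_wf_digraph D by fact
  obtain f where f: "\<And>u v. (u, v) \<in> parcs D \<Longrightarrow> (f u, f v) \<in> parcs (TC n)"
    using hom unfolding admits_hom_def digraph_hom_def by blast
  have "(u, u) \<notin> parcs D" for u using f TC_irrefl n by fastforce
  then have loopfree: "pair_loopfree_digraph D" by unfold_locales auto
  have oriented: "oriented_graph D"
    using wf f TC_asym[OF n] unfolding oriented_graph_def by blast
  have n2: "n \<ge> 2" using n by simp
  note no = not_has_inducedI[OF hom]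
  show ?thesis
    by (intro conjI loopfree oriented no T4a_not_hom_TC T4b_not_hom_TC RT5_not_hom_TC
        T5c_not_hom_TC TT_not_hom_TC TC_Suc_not_hom_TC n n2)
qed

subsection \<open>The structure of components\<close>

text \<open>The height of \<open>v\<close> is the number of steps in a longest chain of
  \<open>Q\<close> that ends at \<open>v\<close>; transitivity lets a chain ending at
  \<open>u\<close> be prolonged along \<open>R u v\<close>.\<close>

lemma bounded_height:
  fixes R :: "'a \<Rightarrow> 'a \<Rightarrow> bool"
  assumes trans: "\<And>u v w. u \<in> Q \<Longrightarrow> v \<in> Q \<Longrightarrow> w \<in> Q \<Longrightarrow> R u v \<Longrightarrow> R v w \<Longrightarrow> R u w"
    and bound: "\<And>g :: nat \<Rightarrow> 'a. (\<And>i. i < m \<Longrightarrow> g i \<in> Q) \<Longrightarrow>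
      (\<And>i j. i < j \<Longrightarrow> j < m \<Longrightarrow> R (g i) (g j)) \<Longrightarrow> False"
  obtains h :: "'a \<Rightarrow> nat" where "\<And>v. v \<in> Q \<Longrightarrow> h v + 1 < m"
    and "\<And>u v. u \<in> Q \<Longrightarrow> v \<in> Q \<Longrightarrow> R u v \<Longrightarrow> h u < h v"
proof -
  \<comment> \<open>\<open>L k v\<close> describes chains with \<open>k + 1\<close> elements, so
    excluding \<open>m\<close> elements gives \<open>k + 1 < m\<close>. All pairs are related, not
    only consecutive ones, to match transitive tournaments.\<close>
  define L where "L k v \<longleftrightarrow> (\<exists>g :: nat \<Rightarrow> 'a. g k = v \<and> (\<forall>i\<le>k. g i \<in> Q) \<and>
    (\<forall>i j. i < j \<longrightarrow> j \<le> k \<longrightarrow> R (g i) (g j)))" for k v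
  have L0: "L 0 v" if "v \<in> Q" for v
    using that by (auto simp: L_def intro!: exI[of _ "\<lambda>_. v"])
  have L_less: "k + 1 < m" if "L k v" for k v
  proof (rule ccontr)
    assume "\<not> k + 1 < m"
    moreover obtain g where "\<forall>i\<le>k. g i \<in> Q" "\<forall>i j. i < j \<longrightarrow> j \<le> k \<longrightarrow> R (g i) (g j)"
      using \<open>L k v\<close> by (auto simp: L_def)
    ultimately show False by (intro bound[of g]) auto
  qed
  have L_Suc: "L (Suc k) v" if "L k u" "v \<in> Q" "R u v" for k u v
  proof -
    obtain g where g: "g k = u" "\<forall>i\<le>k. g i \<in> Q" "\<forall>i j. i < j \<longrightarrow> j \<le> k \<longrightarrow> R (g i) (g j)"
      using \<open>L k u\<close> by (auto simp: L_def)
    have "R (g i) v" if "i \<le> k" for i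
      using that g \<open>v \<in> Q\<close> \<open>R u v\<close> trans[of "g i" u v] by (cases "i = k") auto
    then show ?thesis
      unfolding L_def using g \<open>v \<in> Q\<close> by (intro exI[of _ "g(Suc k := v)"]) (auto simp: le_Suc_eq)
  qed
  define h where "h v = (GREATEST k. L k v)" for v
  have bdd: "k \<le> m" if "L k v" for k v
    using L_less[OF that] by simp
  have h: "L (h v) v" if "v \<in> Q" for v
    unfolding h_def by (rule GreatestI_nat[where P = "\<lambda>k. L k v" and k = 0 and b = m, OF L0[OF that] bdd])
  have h_ge: "k \<le> h v" if "L k v" for k v
    unfolding h_def by (rule Greatest_le_nat[where P = "\<lambda>k. L k v" and b = m, OF that bdd])
  show thesis
  proof (rule that[of h])
    show "h v + 1 < m" if "v \<in> Q" for v using h[OF that] L_less by blast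
    show "h u < h v" if "u \<in> Q" "v \<in> Q" "R u v" for u v
      using h_ge[OF L_Suc[OF h]] that by fastforce
  qed
qed

section \<open>Local consequences of the forbidden subgraphs\<close>

locale obstruction_free =
  fixes D :: "'a pair_pre_digraph" and n :: nat
  assumes n: "n \<ge> 3"
    and no_dipath3: "\<not> has_induced D dipath3"
    and loopfree: "pair_loopfree_digraph D"
    and oriented: "oriented_graph D"
    and no_T4a: "\<not> has_induced D T4a" and no_T4b: "\<not> has_induced D T4b"
    and no_RT5: "\<not> has_induced D RT5" and no_T5c: "\<not> has_induced D T5c"
    and no_TT: "\<not> has_induced D (TT n)" and no_TC: "\<not> has_induced D (TC (n + 1))"
begin

abbreviation arc :: "'a \<Rightarrow> 'a \<Rightarrow> bool" (infix "\<leadsto>" 50) where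
  "u \<leadsto> v \<equiv> (u, v) \<in> parcs D"

lemma arc_irrefl: "\<not> u \<leadsto> u"
  using pair_loopfree_digraph.pair_no_loops[OF loopfree] by fastforce

lemma arc_asym: "u \<leadsto> v \<Longrightarrow> \<not> v \<leadsto> u"
  using oriented arc_irrefl by (metis oriented_graph_def)

text \<open>Otherwise \<open>u, v, w\<close> would induce a directed path.\<close>

lemma quasi_transitive:
  assumes "u \<leadsto> v" "v \<leadsto> w"
  shows "u \<leadsto> w \<or> w \<leadsto> u"
proof (rule ccontr)
  interpret D: pair_loopfree_digraph D by (rule loopfree)
  assume *: "\<not> (u \<leadsto> w \<or> w \<leadsto> u)"
  have "u \<noteq> v" "v \<noteq> w" "u \<noteq> w" using assms arc_irrefl arc_asym by blast+
  moreover have "pair_wf_digraph dipath3"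
    by (auto simp: dipath3_def intro!: pair_wf_digraphI)
  moreover have "u \<in> pverts D" "v \<in> pverts D" "w \<in> pverts D"
    using assms D.in_arcsD1 D.in_arcsD2 by blast+
  moreover have "\<not> v \<leadsto> u" "\<not> w \<leadsto> v" using assms arc_asym by blast+
  ultimately have "has_induced D dipath3"
    using assms * arc_irrefl
    by (intro has_inducedI[where g = "((\<lambda>_. w)(1 := u, 2 := v))"] D.pair_wf_digraph_axioms)
      (auto simp: dipath3_def)
  then show False using no_dipath3 by simp
qed

lemmas tournament_has_induced = tournament_has_inducedI[OF loopfree oriented]

definition triangle :: "'a \<Rightarrow> 'a \<Rightarrow> 'a \<Rightarrow> bool" where
  "triangle a b c \<longleftrightarrow> a \<leadsto> b \<and> b \<leadsto> c \<and> c \<leadsto> a"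

lemma triangle_rotate: "triangle a b c \<Longrightarrow> triangle b c a"
  by (auto simp: triangle_def)

lemma not_dominates_triangle:
  assumes "triangle a b c" "v \<leadsto> a" "v \<leadsto> b" shows "\<not> v \<leadsto> c"
proof
  assume "v \<leadsto> c"
  with assms have "has_induced D T4a"
    by (intro tournament_has_induced[where g = "(\<lambda>_. v)(2 := a, 3 := b, 4 := c)"] tournament_T4a)
      (auto simp: T4a_def triangle_def)
  then show False using no_T4a by simp
qed

lemma not_dominated_by_triangle:
  assumes "triangle a b c" "a \<leadsto> v" "b \<leadsto> v" shows "\<not> c \<leadsto> v"
proof
  assume "c \<leadsto> v"
  with assms have "has_induced D T4b"
    by (intro tournament_has_induced[where g = "(\<lambda>_. v)(2 := a, 3 := b, 4 := c)"] tournament_T4b)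
      (auto simp: T4b_def triangle_def)
  then show False using no_T4b by simp
qed

lemma no_RT5_pattern:
  assumes "v0 \<leadsto> v1" "v1 \<leadsto> v2" "v2 \<leadsto> v3" "v3 \<leadsto> v4" "v4 \<leadsto> v0"
    "v0 \<leadsto> v3" "v1 \<leadsto> v4" "v2 \<leadsto> v0" "v3 \<leadsto> v1" "v4 \<leadsto> v2"
  shows False
proof -
  have "has_induced D RT5"
    using assms
    by (intro tournament_has_induced
        [where g = "(\<lambda>_. v0)(1 := v1, 2 := v2, 3 := v3, 4 := v4)"] tournament_RT5)
      (auto simp: parcs_RT5 pverts_RT5)
  then show False using no_RT5 by simp
qed

text \<open>Here \<open>x, y, z, w\<close> play the vertices \<open>1\<close> to \<open>4\<close> of
  \<open>T5c\<close>, and \<open>c\<close> plays \<open>5\<close>.\<close>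

lemma no_T5c_pattern:
  assumes "x \<leadsto> y" "z \<leadsto> w" "x \<leadsto> z" "x \<leadsto> w" "y \<leadsto> z" "y \<leadsto> w"
    "c \<leadsto> x" "c \<leadsto> y" "z \<leadsto> c" "w \<leadsto> c"
  shows False
proof -
  have "has_induced D T5c"
    using assms
    by (intro tournament_has_induced
        [where g = "(\<lambda>_. c)(1 := x, 2 := y, 3 := z, 4 := w)"] tournament_T5c)
      (auto simp: T5c_def)
  then show False using no_T5c by simp
qed

lemma no_TT_pattern:
  fixes g :: "nat \<Rightarrow> 'a"
  assumes "\<And>i j. i < j \<Longrightarrow> j < n \<Longrightarrow> g i \<leadsto> g j"
  shows False
proof -
  have "{1..n} \<noteq> {v}" for v
    using n by (auto dest: arg_cong[of _ _ card])
  moreover have "g (i - 1) \<leadsto> g (j - 1)" if "(i, j) \<in> parcs (TT n)" for i j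
    using that assms[of "i - 1" "j - 1"] by (auto simp: in_parcs_TT)
  ultimately have "has_induced D (TT n)"
    by (intro tournament_has_induced[where g = "\<lambda>i. g (i - 1)"] tournament_TT) auto
  then show False using no_TT by simp
qed

lemma no_TC_pattern:
  fixes g :: "nat \<Rightarrow> 'a"
  assumes chain: "\<And>i j. i < j \<Longrightarrow> j < n - 1 \<Longrightarrow> g i \<leadsto> g j"
    and "b \<leadsto> a" "\<And>i. i < n - 1 \<Longrightarrow> a \<leadsto> g i" "\<And>i. i < n - 1 \<Longrightarrow> g i \<leadsto> b"
  shows False
proof -
  \<comment> \<open>The vertex \<open>a\<close> plays \<open>1\<close> and \<open>b\<close> plays
    \<open>n + 1\<close>, so the reversed arc is the one from \<open>b\<close> to \<open>a\<close>.
    The \<open>n - 1\<close> chain elements fill \<open>2\<close> to \<open>n\<close>, hence the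
    shift by two.\<close>
  let ?g = "\<lambda>i. if i = 1 then a else if i = n + 1 then b else g (i - 2)"
  have "{1..n + 1} \<noteq> {v}" for v
    using n by (auto dest: arg_cong[of _ _ card])
  moreover have "?g i \<leadsto> ?g j" if "(i, j) \<in> parcs (TC (n + 1))" for i j
  proof -
    consider "i = n + 1" "j = 1" | "i = 1" "1 < j" "j < n + 1" | "1 < i" "i < n + 1" "j = n + 1"
      | "1 < i" "i < j" "j < n + 1"
      using \<open>(i, j) \<in> parcs (TC (n + 1))\<close> unfolding in_parcs_TC by linarith
    then show ?thesis
    proof cases
      case 1 then show ?thesis using assms n by auto
    next
      case 2 then show ?thesis using assms(3)[of "j - 2"] n by auto
    next
      case 3 then show ?thesis using assms(4)[of "i - 2"] n by auto
    next
      case 4 then show ?thesis using chain[of "i - 2" "j - 2"] n by auto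
    qed
  qed
  ultimately have "has_induced D (TC (n + 1))"
    using n by (intro tournament_has_induced[where g = ?g] tournament_TC) auto
  then show False using no_TC by simp
qed

text \<open>\<open>class_of b c\<close> consists of the vertices that can replace \<open>a\<close> in a triangle \<open>a, b, c\<close>.\<close>

definition class_of :: "'a \<Rightarrow> 'a \<Rightarrow> 'a set" where
  "class_of b c = {v. v \<leadsto> b \<and> c \<leadsto> v}"

text \<open>Quasi-transitivity carries adjacency around the triangle, forwards from \<open>a\<close>
  if \<open>v\<close> dominates \<open>a\<close> and backwards otherwise, until the direction of the
  arc changes. It must change, because \<open>v\<close> neither dominates nor is dominated by the
  whole triangle, and the place of the change determines the class.\<close>

lemma adjacent_triangle_aux:
  assumes "triangle a b c" "v \<leadsto> a \<or> a \<leadsto> v"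
  shows "v \<in> class_of b c \<union> class_of c a \<union> class_of a b"
  using assms quasi_transitive not_dominates_triangle[of a b c v] not_dominated_by_triangle[of a b c v]
  unfolding class_of_def triangle_def by blast

lemma adjacent_triangle:
  assumes "triangle a b c" "w \<in> {a, b, c}" "v \<leadsto> w \<or> w \<leadsto> v"
  shows "v \<in> class_of b c \<union> class_of c a \<union> class_of a b"
  using assms adjacent_triangle_aux[of a b c v] adjacent_triangle_aux[of b c a v]
    adjacent_triangle_aux[of c a b v] triangle_rotate by blast

text \<open>
  A neighbour of a vertex replacing \<open>a\<close> is adjacent to \<open>b\<close> or \<open>c\<close>, since it is adjacent to at least
  two vertices of the new triangle.
\<close>

lemma adjacent_class:
  assumes "triangle a b c" "w \<in> class_of b c" "v \<leadsto> w \<or> w \<leadsto> v"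
  shows "v \<in> class_of b c \<union> class_of c a \<union> class_of a b"
proof -
  have "triangle w b c" using assms by (auto simp: class_of_def triangle_def)
  then have "v \<in> class_of b c \<union> class_of c w \<union> class_of w b"
    using adjacent_triangle[of w b c w v] assms(3) by blast
  then have "(v \<leadsto> b \<or> b \<leadsto> v) \<or> (v \<leadsto> c \<or> c \<leadsto> v)" by (auto simp: class_of_def)
  then show ?thesis using adjacent_triangle[OF assms(1), of _ v] by blast
qed

section \<open>Weak components and the classes of a triangle\<close>

text \<open>Defined on the whole type: an element outside the vertex set of \<open>D\<close> forms a
  component of its own.\<close>

definition component :: "'a \<Rightarrow> 'a set" where
  "component x = {y. (x, y) \<in> (symcl (parcs D))\<^sup>*}"

text \<open>The union of the classes contains \<open>a\<close> and is closed under adjacency;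
  rotating the triangle permutes the classes.\<close>

lemma component_triangle:
  assumes "triangle a b c"
  shows "component a \<subseteq> class_of b c \<union> class_of c a \<union> class_of a b"
proof
  fix y assume "y \<in> component a"
  then have "(a, y) \<in> (symcl (parcs D))\<^sup>*" by (simp add: component_def)
  then show "y \<in> class_of b c \<union> class_of c a \<union> class_of a b"
  proof induction
    case base
    then show ?case using assms by (auto simp: class_of_def triangle_def)
  next
    case (step y z)
    then have "z \<leadsto> y \<or> y \<leadsto> z" by (auto simp: symcl_def)
    with step.IH show ?case
      using adjacent_class[of a b c y z] adjacent_class[of b c a y z] adjacent_class[of c a b y z]
        assms triangle_rotate by blast
  qed
qed

text \<open>The path from \<open>v\<close> through \<open>c\<close> to \<open>u\<close> makes
  \<open>u\<close> and \<open>v\<close> adjacent. The wrong direction forces all remaining arcs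
  among \<open>a, v, u, b, c\<close>, and they form \<open>RT5\<close>.\<close>

lemma class_complete:
  assumes abc: "triangle a b c" and u: "u \<in> class_of b c" and v: "v \<in> class_of c a"
  shows "u \<leadsto> v"
proof (rule ccontr)
  assume "\<not> u \<leadsto> v"
  have *: "a \<leadsto> b" "b \<leadsto> c" "c \<leadsto> a" "u \<leadsto> b" "c \<leadsto> u" "v \<leadsto> c" "a \<leadsto> v"
    using assms by (auto simp: class_of_def triangle_def)
  then have "v \<leadsto> u" using quasi_transitive[of v c u] \<open>\<not> u \<leadsto> v\<close> by blast
  \<comment> \<open>With the opposite arc, \<open>v\<close> would dominate the triangle
    \<open>u, b, c\<close>.\<close>
  have "b \<leadsto> v"
    using quasi_transitive[of v u b] not_dominates_triangle[of u b c v] * \<open>v \<leadsto> u\<close>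
    by (auto simp: triangle_def)
  \<comment> \<open>With the opposite arc, the triangle \<open>a, v, c\<close> would dominate
    \<open>u\<close>.\<close>
  moreover have "u \<leadsto> a"
    using quasi_transitive[of a v u] not_dominated_by_triangle[of a v c u] * \<open>v \<leadsto> u\<close>
    by (auto simp: triangle_def)
  ultimately show False
    using no_RT5_pattern[of a v u b c] * \<open>v \<leadsto> u\<close> by blast
qed

definition independent :: "'a set \<Rightarrow> bool" where
  "independent A \<longleftrightarrow> (\<forall>u \<in> A. \<forall>v \<in> A. \<not> u \<leadsto> v)"

text \<open>Arcs inside two consecutive classes, completed by \<open>class_complete\<close> and
  joined with \<open>c\<close>, form \<open>T5c\<close>.\<close>

lemma class_independent:
  assumes "triangle a b c"
  shows "independent (class_of b c) \<or> independent (class_of c a)"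
proof (rule ccontr)
  assume "\<not> ?thesis"
  then obtain x y z w where "x \<in> class_of b c" "y \<in> class_of b c" "x \<leadsto> y"
    "z \<in> class_of c a" "w \<in> class_of c a" "z \<leadsto> w"
    unfolding independent_def by blast
  then show False
    using class_complete[OF assms] no_T5c_pattern[of x y z w c] unfolding class_of_def by blast
qed

section \<open>Homomorphisms on a single component\<close>

text \<open>Without triangles quasi-transitivity becomes transitivity. The shifted height stays in
  \<open>1\<close> to \<open>n - 1\<close>, so the value pair \<open>(1, n)\<close>, which is no arc
  of the target, never occurs.\<close>

lemma component_hom_acyclic:
  assumes acyclic: "\<And>a b c. a \<in> K \<Longrightarrow> \<not> triangle a b c"
  obtains f where "\<And>u. u \<in> K \<Longrightarrow> f u \<in> {1..n}"
    and "\<And>u v. u \<in> K \<Longrightarrow> v \<in> K \<Longrightarrow> u \<leadsto> v \<Longrightarrow> (f u, f v) \<in> parcs (TC n)"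
proof -
  obtain h :: "'a \<Rightarrow> nat" where h: "\<And>v. v \<in> K \<Longrightarrow> h v + 1 < n"
    "\<And>u v. u \<in> K \<Longrightarrow> v \<in> K \<Longrightarrow> u \<leadsto> v \<Longrightarrow> h u < h v"
  proof (rule bounded_height[of K arc n])
    show "u \<leadsto> w" if "u \<in> K" "u \<leadsto> v" "v \<leadsto> w" for u v w
      using that quasi_transitive[of u v w] acyclic[of u v w] by (auto simp: triangle_def)
  qed (use no_TT_pattern in blast)+
  show thesis
    by (rule that[of "\<lambda>v. h v + 1"]) (use h in \<open>fastforce simp: in_parcs_TC\<close>)+
qed

lemma component_hom_cyclic:
  assumes abc: "triangle a b c" and indep: "independent (class_of b c)" "independent (class_of c a)"
  obtains f where "\<And>u. f u \<in> {1..n}"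
    and "\<And>u v. u \<in> component a \<Longrightarrow> v \<in> component a \<Longrightarrow> u \<leadsto> v \<Longrightarrow> (f u, f v) \<in> parcs (TC n)"
proof -
  let ?A = "class_of b c" and ?B = "class_of c a" and ?Q = "class_of a b"
  have bca: "triangle b c a" and cab: "triangle c a b" using abc triangle_rotate by blast+
  note complete = class_complete[OF abc] class_complete[OF bca] class_complete[OF cab]
  have a: "a \<in> ?A" and b: "b \<in> ?B" using abc by (auto simp: class_of_def triangle_def)
  obtain h :: "'a \<Rightarrow> nat" where h: "\<And>v. v \<in> ?Q \<Longrightarrow> h v + 1 < n - 1"
    "\<And>u v. u \<in> ?Q \<Longrightarrow> v \<in> ?Q \<Longrightarrow> u \<leadsto> v \<Longrightarrow> h u < h v"
  proof (rule bounded_height[of ?Q arc "n - 1"])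
    \<comment> \<open>Were the arc reversed, \<open>u, v, w\<close> would be a triangle dominating
      \<open>a\<close>.\<close>
    show "u \<leadsto> w" if "u \<in> ?Q" "v \<in> ?Q" "w \<in> ?Q" "u \<leadsto> v" "v \<leadsto> w" for u v w
      using that quasi_transitive[of u v w] not_dominated_by_triangle[of u v w a]
      by (auto simp: triangle_def class_of_def)
    \<comment> \<open>Such a chain lies between \<open>b\<close> and \<open>a\<close>, which play
      the vertices \<open>1\<close> and \<open>n + 1\<close> of \<open>TC (n + 1)\<close>.\<close>
    show False if "\<And>i. i < n - 1 \<Longrightarrow> g i \<in> ?Q" "\<And>i j. i < j \<Longrightarrow> j < n - 1 \<Longrightarrow> g i \<leadsto> g j"
      for g :: "nat \<Rightarrow> 'a"
      using that abc no_TC_pattern[of g a b] by (auto simp: class_of_def triangle_def)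
  qed blast
  \<comment> \<open>Since \<open>h u\<close> is at most \<open>n - 3\<close> on \<open>?Q\<close>,
    the values there are \<open>2\<close> to \<open>n - 1\<close>. The default \<open>1\<close>
    serves \<open>?B\<close> and also everything outside the component.\<close>
  define f where "f u = (if u \<in> ?A then n else if u \<in> ?Q then h u + 2 else 1)" for u
  have disjoint: "?A \<inter> ?B = {}" "?A \<inter> ?Q = {}" "?B \<inter> ?Q = {}"
    using arc_asym by (auto simp: class_of_def)
  have f: "u \<in> ?A \<Longrightarrow> f u = n" "u \<in> ?B \<Longrightarrow> f u = 1" "u \<in> ?Q \<Longrightarrow> f u = h u + 2" for u
    using disjoint by (auto simp: f_def)
  show thesis
  proof (rule that[of f])
    show "f u \<in> {1..n}" for u using h(1)[of u] n by (auto simp: f_def)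
    show "(f u, f v) \<in> parcs (TC n)" if "u \<in> component a" "v \<in> component a" "u \<leadsto> v" for u v
    proof -
      have "u \<in> ?A \<union> ?B \<union> ?Q" "v \<in> ?A \<union> ?B \<union> ?Q"
        using that component_triangle[OF abc] by auto
      \<comment> \<open>Independence rules out arcs inside \<open>?A\<close> and \<open>?B\<close>;
        completeness with asymmetry rules out arcs against the cyclic order of the classes.\<close>
      with \<open>u \<leadsto> v\<close> indep complete arc_asym
      consider "u \<in> ?A" "v \<in> ?B" | "u \<in> ?B" "v \<in> ?Q" | "u \<in> ?Q" "v \<in> ?A" | "u \<in> ?Q" "v \<in> ?Q"
        unfolding independent_def by blast
      then show ?thesis
      proof cases
        case 1 then show ?thesis by (simp add: f in_parcs_TC)
      next
        case 2 then show ?thesis using h(1)[of v] by (auto simp: f in_parcs_TC)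
      next
        case 3 then show ?thesis using h(1)[of u] by (auto simp: f in_parcs_TC)
      next
        case 4 then show ?thesis using h(1)[of v] h(2)[of u v] \<open>u \<leadsto> v\<close> by (simp add: f in_parcs_TC)
      qed
    qed
  qed
qed

lemma component_eq:
  assumes "y \<in> component x"
  shows "component y = component x"
proof -
  have "sym ((symcl (parcs D))\<^sup>*)" by (intro sym_rtrancl) (auto simp: sym_def symcl_def)
  then show ?thesis using assms by (auto simp: component_def dest: symD intro: rtrancl_trans)
qed

lemma component_hom:
  "\<exists>f. \<forall>u \<in> component x. f u \<in> {1..n} \<and>
     (\<forall>v \<in> component x. u \<leadsto> v \<longrightarrow> (f u, f v) \<in> parcs (TC n))"
proof (cases "\<exists>a \<in> component x. \<exists>b c. triangle a b c")
  case False
  then show ?thesis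
    using component_hom_acyclic[of "component x"] by metis
next
  case True
  then obtain a b c where "a \<in> component x" and abc: "triangle a b c" by blast
  then have bca: "triangle b c a" and cab: "triangle c a b" using triangle_rotate by blast+
  have "(a, b) \<in> symcl (parcs D)" "(a, c) \<in> symcl (parcs D)"
    using abc by (auto simp: triangle_def symcl_def)
  then have "component a = component x" "component b = component x" "component c = component x"
    using component_eq[of b a] component_eq[of c a] component_eq[OF \<open>a \<in> component x\<close>]
    by (auto simp: component_def)
  \<comment> \<open>Each of the three pairs of classes has an independent member, so at least two
    classes are independent, and a rotation of the triangle puts them in the required
    position.\<close>
  moreover have "independent (class_of b c) \<and> independent (class_of c a) \<or>
    independent (class_of c a) \<and> independent (class_of a b) \<or>
    independent (class_of a b) \<and> independent (class_of b c)"
    using class_independent[OF abc] class_independent[OF bca] class_independent[OF cab] by blast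
  ultimately show ?thesis
    using component_hom_cyclic[OF abc] component_hom_cyclic[OF bca] component_hom_cyclic[OF cab]
    by metis
qed

section \<open>Gluing the components and the equivalence\<close>

lemma admits_hom_TC: "admits_hom D (TC n)"
proof -
  obtain F where F: "\<And>x u. u \<in> component x \<Longrightarrow> F x u \<in> {1..n}"
    "\<And>x u v. u \<in> component x \<Longrightarrow> v \<in> component x \<Longrightarrow> u \<leadsto> v \<Longrightarrow> (F x u, F x v) \<in> parcs (TC n)"
    using component_hom by metis
  text \<open>One homomorphism is chosen per component, not per vertex.\<close>
  define f where "f u = F (SOME x. component x = component u) u" for u
  have some: "component (SOME x. component x = component u) = component u" for u
    by (rule someI_ex) blast
  have self: "u \<in> component u" for u by (simp add: component_def)
  have "(f u, f v) \<in> parcs (TC n)" if "u \<leadsto> v" for u v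
  proof -
    \<comment> \<open>Both endpoints lie in one component, so the choice yields the same
      representative and the same map for them.\<close>
    have "v \<in> component u" using that by (auto simp: component_def symcl_def)
    then show ?thesis
      using F(2)[of u "SOME x. component x = component u" v] that some[of u] self[of u]
        component_eq[of v u] by (simp add: f_def)
  qed
  moreover have "f u \<in> {1..n}" for u
    using F(1) some self by (simp add: f_def)
  ultimately show ?thesis
    by (auto simp: admits_hom_def digraph_hom_def)
qed

end

theorem theorem60:
  fixes D :: "'a pair_pre_digraph" and n :: nat
  assumes "n \<ge> 4"
    and "pair_wf_digraph D"
    and "\<not> has_induced D dipath3"
  shows "admits_hom D (TC n) \<longleftrightarrow>
    pair_loopfree_digraph D \<and> oriented_graph D \<and>
    \<not> has_induced D T4a \<and> \<not> has_induced D T4b \<and>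
    \<not> has_induced D RT5 \<and> \<not> has_induced D T5c \<and>
    \<not> has_induced D (TT n) \<and> \<not> has_induced D (TC (n + 1))"
proof
  have n: "n \<ge> 3" using assms(1) by simp
  show "pair_loopfree_digraph D \<and> oriented_graph D \<and>
    \<not> has_induced D T4a \<and> \<not> has_induced D T4b \<and>
    \<not> has_induced D RT5 \<and> \<not> has_induced D T5c \<and>
    \<not> has_induced D (TT n) \<and> \<not> has_induced D (TC (n + 1))" if "admits_hom D (TC n)"
    using admits_hom_TC_obstruction_free[OF n assms(2) that] .
  show "admits_hom D (TC n)" if "pair_loopfree_digraph D \<and> oriented_graph D \<and>
    \<not> has_induced D T4a \<and> \<not> has_induced D T4b \<and>
    \<not> has_induced D RT5 \<and> \<not> has_induced D T5c \<and>
    \<not> has_induced D (TT n) \<and> \<not> has_induced D (TC (n + 1))"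
    using that n assms(3) by (intro obstruction_free.admits_hom_TC obstruction_free.intro) auto
qed

end
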